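(* Let $T\ge 1$ and let $(\mathbf X_m,\mathbf y_m)$, $m=1,\dots,T$, with $\mathbf X_m\in\mathbb R^{n_m\times d}$ and $\mathbf y_m\in\mathbb R^{n_m}$, be jointly realizable, i.e. there exists $\mathbf w\in\mathbb R^d$ with $\mathbf X_m\mathbf w=\mathbf y_m$ for all $m\in\{1,\dots,T\}$. For each $m$ define $f_m:\mathbb R^d\to\mathbb R$ by $f_m(\mathbf w)=\tfrac12\|\mathbf X_m^+(\mathbf X_m\mathbf w-\mathbf y_m)\|^2$. Then each $f_m$ is convex and $1$-smooth, and for every $k\ge1$ and every ordering $\tau:\{1,\dots,k\}\to\{1,\dots,T\}$, the iterates $\mathbf w_0,\dots,\mathbf w_k$ of the block Kaczmarz method $$\mathbf w_0=\mathbf 0,\qquad \mathbf w_t=\mathbf w_{t-1}-\mathbf X_{\tau(t)}^+\big(\mathbf X_{\tau(t)}\mathbf w_{t-1}-\mathbf y_{\tau(t)}\big),\quad t=1,\dots,k,$$ coincide with the iterates of stochastic gradient descent with step size $\eta=1$ on the functions $f_m$, $$\mathbf w_0=\mathbf 0,\qquad \mathbf w_t=\mathbf w_{t-1}-\nabla f_{\tau(t)}(\mathbf w_{t-1}),\quad t=1,\dots,k.$$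
   Context: $\mathbf X^+$ denotes the Moore--Penrose pseudo-inverse and $\|\cdot\|$ the Euclidean norm. A differentiable function $f$ is $\beta$-smooth if $\|\nabla f(\mathbf w)-\nabla f(\mathbf z)\|\le\beta\|\mathbf w-\mathbf z\|$ for all $\mathbf w,\mathbf z\in\mathbb R^d$. *)

theory Defs
  imports "HOL-Analysis.Analysis" "Jordan_Normal_Form.Matrix"
begin

no_notation Matrix.vec_index (infixl "$" 100)

(* The blocks X_m have row counts n_m that vary with m, so they are matrices of type "real mat"
   with explicit dimensions; points of R^d have type "real ^ 'd", so that convexity and derivatives
   are those of HOL-Analysis.  coords and of_coords are mutually inverse translations between
   "real ^ 'd" and "carrier_vec CARD('d)", using the library's fixed enumeration of the
   index type 'd. *)

definition coords :: "real ^ 'd \<Rightarrow> real vec" where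
  "coords w = Matrix.vec CARD('d) (\<lambda>i. w $ from_nat_into UNIV i)"

definition of_coords :: "real vec \<Rightarrow> real ^ 'd" where
  "of_coords v = (\<chi> c. vec_index v (to_nat_on UNIV c))"

definition is_pinv :: "real mat \<Rightarrow> real mat \<Rightarrow> bool" where
  "is_pinv A P \<longleftrightarrow>
     P \<in> carrier_mat (dim_col A) (dim_row A) \<and>
     A * P * A = A \<and>
     P * A * P = P \<and>
     transpose_mat (A * P) = A * P \<and>
     transpose_mat (P * A) = P * A"

definition pinv :: "real mat \<Rightarrow> real mat" where
  "pinv A = (THE P. is_pinv A P)"

definition gradient :: "('a::real_inner \<Rightarrow> real) \<Rightarrow> 'a \<Rightarrow> 'a" where
  "gradient f w = (THE g. GDERIV f w :> g)"

definition smooth :: "real \<Rightarrow> ('a::real_inner \<Rightarrow> real) \<Rightarrow> bool" where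
  "smooth \<beta> f \<longleftrightarrow>
     (\<forall>w. f differentiable (at w)) \<and>
     (\<forall>w z. norm (gradient f w - gradient f z) \<le> \<beta> * norm (w - z))"

definition pinv_residual :: "real mat \<Rightarrow> real vec \<Rightarrow> real ^ 'd \<Rightarrow> real ^ 'd" where
  "pinv_residual A b w = of_coords (pinv A *\<^sub>v (A *\<^sub>v coords w - b))"

definition block_loss :: "real mat \<Rightarrow> real vec \<Rightarrow> real ^ 'd \<Rightarrow> real" where
  "block_loss A b w = 1 / 2 * (norm (pinv_residual A b w :: real ^ 'd))\<^sup>2"

primrec kaczmarz ::
  "(nat \<Rightarrow> real mat) \<Rightarrow> (nat \<Rightarrow> real vec) \<Rightarrow> (nat \<Rightarrow> nat) \<Rightarrow> nat \<Rightarrow> real ^ 'd" where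
  "kaczmarz X y \<tau> 0 = 0"
| "kaczmarz X y \<tau> (Suc t) =
     kaczmarz X y \<tau> t - pinv_residual (X (\<tau> (Suc t))) (y (\<tau> (Suc t))) (kaczmarz X y \<tau> t)"

primrec sgd ::
  "real \<Rightarrow> (nat \<Rightarrow> 'a::real_inner \<Rightarrow> real) \<Rightarrow> (nat \<Rightarrow> nat) \<Rightarrow> nat \<Rightarrow> 'a" where
  "sgd \<eta> f \<tau> 0 = 0"
| "sgd \<eta> f \<tau> (Suc t) =
     sgd \<eta> f \<tau> t - \<eta> *\<^sub>R gradient (f (\<tau> (Suc t))) (sgd \<eta> f \<tau> t)"

end

theory Submission
  imports Defs
begin

text \<open>Since \<open>P = X\<^sup>+ X\<close> is the orthogonal projection onto the row space of \<open>X\<close>, realizability by \<open>a\<close>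
  turns \<open>X\<^sup>+ (X w - y)\<close> into \<open>P (w - a)\<close>. Hence the loss is \<open>1/2 \<parallel>P (w - a)\<parallel>\<^sup>2\<close>, whose gradient
  \<open>P\<^sup>T P (w - a) = P (w - a)\<close> is the Kaczmarz step itself. As \<open>X\<^sup>+\<close> is a definite description, its
  existence has to be proved; it is \<open>(X\<^sup>T X)\<^sup>+ X\<^sup>T\<close>.\<close>

section \<open>Coordinates\<close>

lemma coords_carrier [simp]: "coords (w :: real ^ 'd) \<in> carrier_vec CARD('d)"
  by (simp add: coords_def)

lemma dim_coords [simp]: "dim_vec (coords (w :: real ^ 'd)) = CARD('d)"
  by (simp add: coords_def)

lemma to_nat_on_UNIV_less: "to_nat_on UNIV (c :: 'd :: finite) < CARD('d)"
  using to_nat_on_finite[of "UNIV :: 'd set"] by (auto simp: bij_betw_def)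

lemma to_nat_on_from_nat_into_UNIV:
  assumes "i < CARD('d :: finite)"
  shows "to_nat_on UNIV (from_nat_into UNIV i :: 'd) = i"
proof -
  have "to_nat_on (UNIV :: 'd set) ` UNIV = {..<CARD('d)}"
    using to_nat_on_finite[of "UNIV :: 'd set"] by (auto simp: bij_betw_def)
  with assms show ?thesis
    by (intro to_nat_on_from_nat_into) auto
qed

lemma of_coords_coords [simp]: "of_coords (coords w) = (w :: real ^ 'd)"
  by (simp add: of_coords_def coords_def Finite_Cartesian_Product.vec_eq_iff to_nat_on_UNIV_less)

lemma coords_of_coords [simp]:
  "v \<in> carrier_vec CARD('d) \<Longrightarrow> coords (of_coords v :: real ^ 'd) = v"
  by (auto simp: of_coords_def coords_def to_nat_on_from_nat_into_UNIV)

lemma of_coords_add: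
  "u \<in> carrier_vec CARD('d) \<Longrightarrow> v \<in> carrier_vec CARD('d) \<Longrightarrow>
    (of_coords (u + v) :: real ^ 'd) = of_coords u + of_coords v"
  by (auto simp: of_coords_def Finite_Cartesian_Product.vec_eq_iff to_nat_on_UNIV_less)

lemma of_coords_smult:
  "u \<in> carrier_vec CARD('d) \<Longrightarrow> (of_coords (c \<cdot>\<^sub>v u) :: real ^ 'd) = c *\<^sub>R of_coords u"
  by (auto simp: of_coords_def Finite_Cartesian_Product.vec_eq_iff to_nat_on_UNIV_less)

lemma coords_add: "coords (u + v :: real ^ 'd) = coords u + coords v"
  by (auto simp: coords_def)

lemma coords_diff: "coords (u - v :: real ^ 'd) = coords u - coords v"
  by (auto simp: coords_def)

lemma coords_scaleR: "coords (c *\<^sub>R u :: real ^ 'd) = c \<cdot>\<^sub>v coords u"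
  by (auto simp: coords_def)

text \<open>The enumeration of \<open>'d\<close> is a bijection, so both sides are one sum,
  reindexed. Through this, transposes of matrices become adjoints of operators.\<close>

lemma inner_eq_scalar_prod_coords:
  "inner u v = scalar_prod (coords u) (coords (v :: real ^ 'd))"
proof -
  have bij: "bij_betw (from_nat_into UNIV) {0..<CARD('d)} (UNIV :: 'd set)"
    using bij_betw_from_nat_into_finite[of "UNIV :: 'd set"] by (simp add: atLeast0LessThan)
  show ?thesis
    by (simp add: inner_vec_def scalar_prod_def coords_def sum.reindex_bij_betw[OF bij, symmetric])
qed

text \<open>Lets a square matrix act on \<open>real ^ 'd\<close>, so that results about linear maps
  and inner products there apply to it.\<close>

definition mat_op :: "real mat \<Rightarrow> real ^ 'd \<Rightarrow> real ^ 'd" where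
  "mat_op A w = of_coords (A *\<^sub>v coords w)"

lemma coords_mat_op:
  "A \<in> carrier_mat CARD('d) CARD('d) \<Longrightarrow> coords (mat_op A w :: real ^ 'd) = A *\<^sub>v coords w"
  by (simp add: mat_op_def mult_mat_vec_carrier[of _ "CARD('d)" "CARD('d)"])

lemma linear_mat_op:
  assumes A: "A \<in> carrier_mat CARD('d) CARD('d)"
  shows "linear (mat_op A :: real ^ 'd \<Rightarrow> real ^ 'd)"
proof
  fix u v :: "real ^ 'd" and c :: real
  have car: "A *\<^sub>v coords w \<in> carrier_vec CARD('d)" for w :: "real ^ 'd"
    using A by (rule mult_mat_vec_carrier) simp
  show "mat_op A (u + v) = mat_op A u + mat_op A v"
    using A car by (simp add: mat_op_def coords_add mult_add_distrib_mat_vec of_coords_add)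
  show "mat_op A (c *\<^sub>R u) = c *\<^sub>R mat_op A u"
    using A car by (simp add: mat_op_def coords_scaleR mult_mat_vec of_coords_smult)
qed

lemma mat_op_mult:
  assumes "A \<in> carrier_mat CARD('d) CARD('d)" "B \<in> carrier_mat CARD('d) CARD('d)"
  shows "mat_op (A * B) (w :: real ^ 'd) = mat_op A (mat_op B w)"
  using assms assoc_mult_mat_vec[of A "CARD('d)" "CARD('d)" B "CARD('d)" "coords w"]
  by (simp add: mat_op_def[of A] mat_op_def[of "A * B"] coords_mat_op)

lemma inner_mat_op:
  assumes "A \<in> carrier_mat CARD('d) CARD('d)"
  shows "inner (mat_op (transpose_mat A) u) (v :: real ^ 'd) = inner u (mat_op A v)"
  using assms
  by (simp add: inner_eq_scalar_prod_coords coords_mat_op transpose_vec_mult_scalar)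

text \<open>The columns of \<open>B\<close> are the images under \<open>g\<close> of the standard
  basis vectors. This brings a map whose existence is known only abstractly back to a
  matrix.\<close>

lemma exists_mat_op_eq:
  assumes g: "linear (g :: real ^ 'd \<Rightarrow> real ^ 'd)"
  obtains B where "B \<in> carrier_mat CARD('d) CARD('d)" "mat_op B = g"
proof
  let ?e = "from_nat_into UNIV :: nat \<Rightarrow> 'd"
  define B where "B = Matrix.mat CARD('d) CARD('d) (\<lambda>(i, j). g (axis (?e j) 1) $ ?e i)"
  show B: "B \<in> carrier_mat CARD('d) CARD('d)"
    by (simp add: B_def)
  have bij: "bij_betw ?e {0..<CARD('d)} UNIV"
    using bij_betw_from_nat_into_finite[of "UNIV :: 'd set"] by (simp add: atLeast0LessThan)
  show "mat_op B = g"
  proof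
    fix w
    have "mat_op B w $ c = g w $ c" for c
    proof -
      have "mat_op B w $ c = (\<Sum>j\<in>{0..<CARD('d)}. g (axis (?e j) 1) $ c * (w $ ?e j))"
        by (simp add: mat_op_def of_coords_def B_def to_nat_on_UNIV_less scalar_prod_def coords_def)
      also have "\<dots> = (\<Sum>k\<in>UNIV. g (axis k 1) $ c * (w $ k))"
        by (rule sum.reindex_bij_betw[OF bij])
      also have "\<dots> = g (\<Sum>k\<in>UNIV. (w $ k) *\<^sub>R axis k 1) $ c"
        by (simp add: linear_sum[OF g] linear_cmul[OF g] mult.commute)
      also have "(\<Sum>k\<in>UNIV. (w $ k) *\<^sub>R axis k 1) = w"
        using basis_expansion[of w] by (simp add: scalar_mult_eq_scaleR)
      finally show ?thesis .
    qed
    then show "mat_op B w = g w"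
      by (simp add: Finite_Cartesian_Product.vec_eq_iff)
  qed
qed

lemma mat_op_inject:
  assumes A: "A \<in> carrier_mat CARD('d) CARD('d)" and B: "B \<in> carrier_mat CARD('d) CARD('d)"
    and eq: "\<And>w :: real ^ 'd. mat_op A w = mat_op B w"
  shows "A = B"
proof (rule mat_col_eqI)
  fix j assume "j < dim_col B"
  with B have j: "j < CARD('d)" by simp
  have "A *\<^sub>v unit_vec CARD('d) j = B *\<^sub>v unit_vec CARD('d) j"
    using eq[of "of_coords (unit_vec CARD('d) j)"] coords_mat_op[OF A] coords_mat_op[OF B]
    by (metis coords_of_coords unit_vec_carrier)
  then show "col A j = col B j"
    using A B j col_mult2[OF A one_carrier_mat j] col_mult2[OF B one_carrier_mat j] by simp
qed (use A B in auto)

section \<open>The Moore--Penrose inverse\<close>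

text \<open>A linear map has a linear right inverse \<open>g\<close> on its range, and the matrix of
  \<open>g\<close> serves as \<open>H\<close>. The dimension is \<open>CARD('d)\<close> because the
  argument runs through operators on \<open>real ^ 'd\<close>.\<close>

lemma exists_inner_inverse:
  assumes K: "K \<in> carrier_mat CARD('d) CARD('d :: finite)"
  obtains H :: "real mat" where "H \<in> carrier_mat CARD('d) CARD('d)" "K * H * K = K"
proof -
  let ?f = "mat_op K :: real ^ 'd \<Rightarrow> real ^ 'd"
  obtain g where g: "linear g" and inv: "\<And>v. ?f (g (?f v)) = ?f v"
    using linear_exists_right_inverse_on[OF linear_mat_op[OF K] subspace_UNIV] by blast
  obtain H where H: "H \<in> carrier_mat CARD('d) CARD('d)" and Hg: "mat_op H = g"
    using exists_mat_op_eq[OF g] .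
  have "mat_op (K * H * K) w = ?f w" for w :: "real ^ 'd"
    using inv K H by (simp add: mat_op_mult mult_carrier_mat[of _ "CARD('d)" "CARD('d)"] Hg)
  then have "K * H * K = K"
    using mat_op_inject[of "K * H * K" K] K H by (meson mult_carrier_mat)
  with H show ?thesis by (rule that)
qed

text \<open>Each diagonal entry of \<open>transpose_mat B * B\<close> is the sum of squares of a
  column of \<open>B\<close>.\<close>

lemma transpose_mult_self_eq_0:
  fixes B :: "real mat"
  assumes B: "B \<in> carrier_mat n k" and 0: "transpose_mat B * B = 0\<^sub>m k k"
  shows "B = 0\<^sub>m n k"
proof (rule eq_matI)
  fix i j assume "i < dim_row (0\<^sub>m n k :: real mat)" "j < dim_col (0\<^sub>m n k :: real mat)"
  then have i: "i < n" and j: "j < k" by auto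
  have "(transpose_mat B * B) $$ (j, j) = (\<Sum>l\<in>{0..<n}. (B $$ (l, j))\<^sup>2)"
    using B j by (simp add: scalar_prod_def power2_eq_square)
  with 0 j have "(\<Sum>l\<in>{0..<n}. (B $$ (l, j))\<^sup>2) = 0" by simp
  then have "(B $$ (i, j))\<^sup>2 = 0"
    using i by (subst (asm) sum_nonneg_eq_0_iff) auto
  with i j show "B $$ (i, j) = 0\<^sub>m n k $$ (i, j)" by simp
qed (use B in auto)

text \<open>With \<open>D = Y - Z\<close> the Gram matrix of \<open>A * D\<close> is D^T (A^T A D) =
  0, hence \<open>A * D\<close> vanishes.\<close>

lemma gram_mult_cancel:
  fixes A :: "real mat"
  assumes A: "A \<in> carrier_mat n d" and Y: "Y \<in> carrier_mat d k" and Z: "Z \<in> carrier_mat d k"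
    and eq: "transpose_mat A * A * Y = transpose_mat A * A * Z"
  shows "A * Y = A * Z"
proof -
  let ?D = "Y - Z"
  have D: "?D \<in> carrier_mat d k" using Y Z by auto
  have At: "transpose_mat A \<in> carrier_mat d n" and Dt: "transpose_mat ?D \<in> carrier_mat k d"
    using A D by auto
  have G: "transpose_mat A * A \<in> carrier_mat d d" using A At by auto
  have "transpose_mat (A * ?D) * (A * ?D) = transpose_mat ?D * (transpose_mat A * A * ?D)"
    unfolding transpose_mult[OF A D] assoc_mult_mat[OF At A D]
    using assoc_mult_mat[OF Dt At mult_carrier_mat[OF A D]] by simp
  also have "transpose_mat A * A * ?D = 0\<^sub>m d k"
    using mult_minus_distrib_mat[OF G Y Z] eq mult_carrier_mat[OF G Z]
    by (metis minus_r_inv_mat)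
  finally have "transpose_mat (A * ?D) * (A * ?D) = 0\<^sub>m k k"
    using right_mult_zero_mat[OF Dt] by simp
  then have "A * ?D = 0\<^sub>m n k"
    using transpose_mult_self_eq_0[of "A * ?D" n k] A D by auto
  then have 0: "A * Y - A * Z = 0\<^sub>m n k"
    by (simp add: mult_minus_distrib_mat[OF A Y Z])
  show ?thesis
  proof (rule eq_matI)
    fix i j assume "i < dim_row (A * Z)" "j < dim_col (A * Z)"
    then show "(A * Y) $$ (i, j) = (A * Z) $$ (i, j)"
      using arg_cong[OF 0, of "\<lambda>M. M $$ (i, j)"] A Y Z by simp
  qed (use A Y Z in auto)
qed

text \<open>On the range of the symmetric matrix \<open>M\<close>, every inner inverse \<open>H\<close> of \<open>M\<^sup>3\<close> compresses to
  the inverse of \<open>M\<^sup>3\<close>, so \<open>M H M\<close> is the inverse of \<open>M\<close> there and vanishes on the kernel of \<open>M\<close>.\<close>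

lemma symmetric_pinv_exists:
  fixes M H :: "real mat"
  assumes M: "M \<in> carrier_mat d d" and sym: "transpose_mat M = M"
    and H: "H \<in> carrier_mat d d"
    and inv: "M * (M * M) * H * (M * (M * M)) = M * (M * M)"
  obtains Q where "Q \<in> carrier_mat d d" "transpose_mat Q = Q"
    "Q * M = M * Q" "M * Q * M = M" "Q * M * Q = Q"
proof -
  \<comment> \<open>Rewriting with \<open>sq\<close> nests products to the right and pushes
    transposes inward; its closure rules settle the dimension conditions.\<close>
  note sq = assoc_mult_mat[of _ d d _ d _ d] mult_carrier_mat[of _ d d _ d]
    transpose_mult[of _ d d _ d]
  \<comment> \<open>By symmetry \<open>M * M\<close> is the Gram matrix of \<open>M\<close>, so one
    left factor \<open>M\<close> can be cancelled.\<close>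
  have cancel: "M * Y = M * Z"
    if "Y \<in> carrier_mat d d" "Z \<in> carrier_mat d d" "M * (M * Y) = M * (M * Z)" for Y Z
    by (rule gram_mult_cancel[OF M that(1,2)]) (simp only: sym sq M that)
  \<comment> \<open>Two cancellations reduce M^3 H M^3 = M^3 to M H M^3 = M. The claim is general in
    \<open>H\<close> because it is also applied to the transpose.\<close>
  have left: "M * (H * (M * (M * M))) = M"
    if H: "H \<in> carrier_mat d d"
      and inv: "M * (M * M) * H * (M * (M * M)) = M * (M * M)" for H
  proof -
    have "M * (M * (M * (H * (M * (M * M))))) = M * (M * M)"
      using inv by (simp only: sq M H)
    then have "M * (M * (H * (M * (M * M)))) = M * M"
      by (rule cancel[rotated -1]) (simp_all only: sq M H)
    then have "M * (M * (H * (M * (M * M)))) = M * (M * 1\<^sub>m d)"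
      using M by simp
    then have "M * (H * (M * (M * M))) = M * 1\<^sub>m d"
      by (rule cancel[rotated -1]) (simp_all only: sq M H one_carrier_mat)
    then show ?thesis using M by simp
  qed
  have tH: "transpose_mat H \<in> carrier_mat d d" using H by simp
  \<comment> \<open>The transpose of \<open>H\<close> is again an inner inverse of M^3; applying
    \<open>left\<close> to it and transposing back gives the mirrored identity M^3 H M = M.\<close>
  have "M * (M * M) * transpose_mat H * (M * (M * M)) =
      transpose_mat (M * (M * M) * H * (M * (M * M)))"
    by (simp only: sq M H tH sym)
  also have "\<dots> = M * (M * M)"
    by (simp only: inv sq M sym)
  finally have "M * (transpose_mat H * (M * (M * M))) = M"
    by (rule left[OF tH])
  then have "M = transpose_mat (M * (transpose_mat H * (M * (M * M))))"
    by (simp only: sym)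
  also have "\<dots> = M * (M * (M * (H * M)))"
    by (simp only: sq M H tH sym Matrix.transpose_transpose)
  finally have right: "M * (M * (M * (H * M))) = M" by (rule HOL.sym)
  define Q where "Q = M * (H * M)"
  have Q: "Q \<in> carrier_mat d d" by (simp only: Q_def sq M H)
  have QMM: "Q * (M * M) = M" and MMQ: "M * (M * Q) = M"
    by (simp_all only: Q_def sq M H left[OF H inv] right)
  \<comment> \<open>Both products equal \<open>Q * (M * M) * Q\<close>.\<close>
  have QM: "Q * M = M * Q"
  proof -
    have "Q * M = Q * (M * (M * Q))" by (simp only: MMQ)
    also have "\<dots> = Q * (M * M) * Q" by (simp only: sq M Q)
    finally show ?thesis by (simp only: QMM)
  qed
  have MQM: "M * Q * M = M"
    by (simp only: sq M Q QM MMQ)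
  have QMQ: "Q * M * Q = Q"
  proof -
    have "Q * M * Q = M * Q * M * (H * M)"
      unfolding QM by (simp only: Q_def sq M H)
    then show ?thesis unfolding MQM by (simp only: Q_def)
  qed
  have tQ: "transpose_mat Q \<in> carrier_mat d d" using Q by simp
  \<comment> \<open>Transposing the equations for \<open>Q\<close> shows that
    \<open>transpose_mat Q\<close> satisfies them too. Such a commuting inverse is unique: first the
    products with \<open>M\<close> agree, then the matrices themselves.\<close>
  have tQM: "M * transpose_mat Q = transpose_mat Q * M"
    using arg_cong[OF QM, of transpose_mat] by (simp only: sq M Q sym)
  have tMQM: "M * (transpose_mat Q * M) = M"
    using arg_cong[OF MQM, of transpose_mat] by (simp only: sq M Q tQ sym)
  have tQMQ: "transpose_mat Q * (M * transpose_mat Q) = transpose_mat Q"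
    using arg_cong[OF QMQ, of transpose_mat] by (simp only: sq M Q tQ sym)
  have "M * transpose_mat Q = M * Q * M * transpose_mat Q"
    by (simp only: MQM)
  also have "\<dots> = Q * (M * (transpose_mat Q * M))"
    by (simp only: QM[symmetric] sq M Q tQ) (simp only: tQM)
  finally have proj: "M * transpose_mat Q = M * Q"
    by (simp only: tMQM QM)
  have "transpose_mat Q = M * Q * transpose_mat Q"
    using tQMQ by (simp only: proj[symmetric] tQM sq M Q tQ)
  also have "\<dots> = Q * (M * Q)"
    by (simp only: QM[symmetric] sq M Q tQ) (simp only: proj QM)
  also have "\<dots> = Q"
    using QMQ by (simp only: sq M Q)
  finally have "transpose_mat Q = Q" .
  with Q QM MQM QMQ show ?thesis by (intro that)
qed

text \<open>Symmetry of the projections gives A P = (A R A P)^T = A P A R = A R and, dually, P A = R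
  A. Hence P = P A P = R A P = R A R = R.\<close>

lemma is_pinv_unique:
  assumes P: "is_pinv A P" and R: "is_pinv A R"
  shows "P = R"
proof -
  obtain n d where A: "A \<in> carrier_mat n d" by blast
  have Pc: "P \<in> carrier_mat d n" and Rc: "R \<in> carrier_mat d n"
    using P R A by (auto simp: is_pinv_def)
  have AP: "A * P \<in> carrier_mat n n" and AR: "A * R \<in> carrier_mat n n"
    and PA: "P * A \<in> carrier_mat d d" and RA: "R * A \<in> carrier_mat d d"
    using A Pc Rc by auto
  have "A * P = transpose_mat (A * R * A * P)"
    using P R by (simp add: is_pinv_def)
  also have "\<dots> = transpose_mat ((A * R) * (A * P))"
    using assoc_mult_mat[OF AR A Pc] by simp
  also have "\<dots> = A * P * (A * R)"
    using P R by (simp add: transpose_mult[OF AR AP] is_pinv_def)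
  also have "\<dots> = A * P * A * R"
    using assoc_mult_mat[OF AP A Rc] by simp
  finally have 1: "A * P = A * R"
    using P by (simp add: is_pinv_def)
  have "P * A = transpose_mat (P * (A * R * A))"
    using P R by (simp add: is_pinv_def)
  also have "\<dots> = transpose_mat (P * A * (R * A))"
    using assoc_mult_mat[OF Pc A RA] assoc_mult_mat[OF A Rc A] by simp
  also have "\<dots> = R * A * (P * A)"
    using P R by (simp add: transpose_mult[OF PA RA] is_pinv_def)
  also have "\<dots> = R * (A * P * A)"
    using assoc_mult_mat[OF Rc A PA] assoc_mult_mat[OF A Pc A] by simp
  finally have 2: "P * A = R * A"
    using P by (simp add: is_pinv_def)
  have "P = R * A * P" using P 2 by (simp add: is_pinv_def)
  also have "\<dots> = R * A * R" using assoc_mult_mat[OF Rc A Pc] assoc_mult_mat[OF Rc A Rc] 1 by simp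
  finally show ?thesis using R by (simp add: is_pinv_def)
qed

text \<open>With \<open>M\<close> the Gram matrix of \<open>A\<close> and \<open>Q\<close> its
  symmetric commuting inverse, the witness is \<open>Q * transpose_mat A\<close>. Uniqueness then
  identifies it with the \<open>THE\<close> term.\<close>

lemma is_pinv_pinv:
  assumes A: "A \<in> carrier_mat n CARD('d :: finite)"
  shows "is_pinv A (pinv A)"
proof -
  let ?d = "CARD('d)"
  define M where "M = transpose_mat A * A"
  have At: "transpose_mat A \<in> carrier_mat ?d n" using A by simp
  have M: "M \<in> carrier_mat ?d ?d" using A At by (simp add: M_def)
  have sym: "transpose_mat M = M"
    by (simp add: M_def transpose_mult[OF At A])
  have "M * (M * M) \<in> carrier_mat ?d ?d" using M by simp
  then obtain H where H: "H \<in> carrier_mat ?d ?d"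
    and inv: "M * (M * M) * H * (M * (M * M)) = M * (M * M)"
    by (rule exists_inner_inverse)
  obtain Q where Q: "Q \<in> carrier_mat ?d ?d" and Qsym: "transpose_mat Q = Q"
    and QM: "Q * M = M * Q" and MQM: "M * Q * M = M" and QMQ: "Q * M * Q = Q"
    using symmetric_pinv_exists[OF M sym H inv] .
  define P where "P = Q * transpose_mat A"
  have P: "P \<in> carrier_mat ?d n" using Q At by (simp add: P_def)
  have PA: "P * A = Q * M"
    using assoc_mult_mat[OF Q At A] by (simp add: P_def M_def)
  have AQ: "A * Q \<in> carrier_mat n ?d" and MQ: "Q * M \<in> carrier_mat ?d ?d" using A Q M by auto
  \<comment> \<open>Written with an identity factor, M Q M = M has the shape in which Gram
    cancellation strips A^T and leaves A Q M = A.\<close>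
  have "M * (Q * M) = M * 1\<^sub>m ?d"
    using MQM assoc_mult_mat[OF M Q M] M by simp
  then have "A * (Q * M) = A * 1\<^sub>m ?d"
    using gram_mult_cancel[OF A, of "Q * M" ?d "1\<^sub>m ?d"] MQ by (simp add: M_def)
  then have AQM: "A * (Q * M) = A" using A by simp
  have "is_pinv A P"
    unfolding is_pinv_def
  proof (intro conjI)
    show "P \<in> carrier_mat (dim_col A) (dim_row A)" using P A by simp
    show "A * P * A = A"
      using assoc_mult_mat[OF A P A] by (simp add: PA AQM)
    show "P * A * P = P"
      using assoc_mult_mat[OF MQ Q At] QMQ by (simp add: PA) (simp add: P_def)
    have AP: "A * P = A * Q * transpose_mat A"
      using assoc_mult_mat[OF A Q At] by (simp add: P_def)
    show "transpose_mat (A * P) = A * P"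
      unfolding AP transpose_mult[OF AQ At] transpose_mult[OF A Q] Qsym
      using assoc_mult_mat[OF A Q At] by simp
    show "transpose_mat (P * A) = P * A"
      unfolding PA transpose_mult[OF Q M] sym Qsym by (rule QM[symmetric])
  qed
  then show ?thesis
    unfolding pinv_def by (rule theI) (rule is_pinv_unique[OF _ \<open>is_pinv A P\<close>])
qed

section \<open>The block loss\<close>

text \<open>Derivatives are unique, and a vector is determined by its inner products, so the
  \<open>THE\<close> in \<open>gradient\<close> can be evaluated.\<close>

lemma gradient_eqI:
  assumes "GDERIV f w :> g"
  shows "gradient f w = g"
  unfolding gradient_def
proof (rule the_equality)
  fix g' assume "GDERIV f w :> g'"
  with assms have "(\<lambda>h. inner h g') = (\<lambda>h. inner h g)"
    unfolding gderiv_def by (rule has_derivative_unique[rotated])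
  then show "g' = g"
    by (metis vector_eq_ldot)
qed fact

text \<open>The hypotheses say that \<open>L\<close> is an orthogonal projection. All three
  properties of the loss follow from this alone, without coordinates.\<close>

lemma half_norm_sq_projection:
  fixes L :: "'a :: real_inner \<Rightarrow> 'a" and a :: 'a
  assumes L: "bounded_linear L" and idem: "\<And>u. L (L u) = L u"
    and self_adj: "\<And>u v. inner (L u) v = inner u (L v)"
  defines "f \<equiv> \<lambda>w. 1 / 2 * (norm (L (w - a)))\<^sup>2"
  shows "GDERIV f w :> L (w - a)" "convex_on UNIV f" "smooth 1 f"
proof -
  interpret L: bounded_linear L by (rule L)
  show grad: "GDERIV f w :> L (w - a)" for w
  proof -
    have f: "f = (\<lambda>w. 1 / 2 * inner (L (w - a)) (L (w - a)))"
      by (simp add: f_def power2_norm_eq_inner)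
    \<comment> \<open>The derivative of \<open>f\<close> in direction \<open>h\<close> is the left
      side; moving \<open>L\<close> across and using idempotence exposes the gradient.\<close>
    have eq: "inner (L h) (L (w - a)) = inner h (L (w - a))" for h
      by (simp add: self_adj idem)
    have "((\<lambda>w. L (w - a)) has_derivative L) (at w)"
      by (rule has_derivative_eq_rhs[OF L.has_derivative]) (auto intro!: derivative_eq_intros)
    from has_derivative_mult_right[OF has_derivative_inner[OF this this], of "1 / 2"]
    show ?thesis
      unfolding gderiv_def f
      by (rule has_derivative_eq_rhs) (simp add: eq inner_commute[of "L (w - a)"])
  qed
  show "convex_on UNIV f"
  proof (rule convex_onI)
    fix t :: real and u v :: 'a
    assume t: "0 < t" "t < 1"
    let ?p = "L (u - a)" and ?q = "L (v - a)"
    have "(1 - t) *\<^sub>R u + t *\<^sub>R v - a = (1 - t) *\<^sub>R (u - a) + t *\<^sub>R (v - a)"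
      by (simp add: algebra_simps)
    then have *: "L ((1 - t) *\<^sub>R u + t *\<^sub>R v - a) = (1 - t) *\<^sub>R ?p + t *\<^sub>R ?q"
      by (simp only: L.add L.scaleR)
    \<comment> \<open>The convexity gap of the squared norm is computed exactly and is visibly
      nonnegative.\<close>
    have "(1 - t) * (norm ?p)\<^sup>2 + t * (norm ?q)\<^sup>2 - (norm ((1 - t) *\<^sub>R ?p + t *\<^sub>R ?q))\<^sup>2
        = t * (1 - t) * (norm (?p - ?q))\<^sup>2"
      unfolding power2_norm_eq_inner
      by (simp add: inner_add_left inner_add_right inner_diff_left inner_diff_right
          inner_commute[of ?q ?p]) (simp add: algebra_simps)
    moreover have "0 \<le> t * (1 - t) * (norm (?p - ?q))\<^sup>2"
      using t by simp
    ultimately show "f ((1 - t) *\<^sub>R u + t *\<^sub>R v) \<le> (1 - t) * f u + t * f v"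
      unfolding f_def * by linarith
  qed simp
  \<comment> \<open>An orthogonal projection is nonexpansive, which yields the smoothness constant
    1.\<close>
  have "norm (L u) \<le> norm u" for u
  proof -
    have "norm (L u) * norm (L u) = inner u (L u)"
      by (simp add: self_adj idem flip: power2_norm_eq_inner power2_eq_square)
        (simp add: power2_norm_eq_inner self_adj idem)
    also have "\<dots> \<le> norm u * norm (L u)" by (rule norm_cauchy_schwarz)
    finally show ?thesis by (cases "L u = 0") auto
  qed
  from this[of "u - v" for u v] show "smooth 1 f"
    using grad by (auto simp: smooth_def gradient_eqI[OF grad] differentiable_def gderiv_def
        simp flip: L.diff)
qed

text \<open>Realizability enters here: substituting \<open>A *\<^sub>v coords a\<close> for
  \<open>b\<close> turns the affine residual into a linear map of \<open>w - a\<close>.\<close>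

lemma realizable_residual:
  assumes A: "A \<in> carrier_mat n CARD('d)" and b: "A *\<^sub>v coords (a :: real ^ 'd) = b"
  shows "pinv_residual A b (w :: real ^ 'd) = mat_op (pinv A * A) (w - a)"
proof -
  have P: "pinv A \<in> carrier_mat CARD('d) n"
    using is_pinv_pinv[OF A] A by (simp add: is_pinv_def)
  have "A *\<^sub>v coords w - b = A *\<^sub>v coords (w - a)"
    using A by (simp add: coords_diff mult_minus_distrib_mat_vec flip: b)
  with assoc_mult_mat_vec[OF P A] show ?thesis
    by (simp add: pinv_residual_def mat_op_def)
qed

text \<open>The Penrose equations make \<open>pinv A * A\<close> idempotent and symmetric, so the
  results on orthogonal projections apply.\<close>

lemma realizable_block_loss:
  assumes A: "A \<in> carrier_mat n CARD('d)" and b: "A *\<^sub>v coords (a :: real ^ 'd) = b"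
  shows "convex_on UNIV (block_loss A b :: real ^ 'd \<Rightarrow> real)"
    and "smooth 1 (block_loss A b :: real ^ 'd \<Rightarrow> real)"
    and "gradient (block_loss A b) w = pinv_residual A b (w :: real ^ 'd)"
proof -
  let ?E = "pinv A * A" and ?L = "mat_op (pinv A * A) :: real ^ 'd \<Rightarrow> real ^ 'd"
  have P: "pinv A \<in> carrier_mat CARD('d) n"
    using is_pinv_pinv[OF A] A by (simp add: is_pinv_def)
  have E: "?E \<in> carrier_mat CARD('d) CARD('d)" using P A by simp
  have Esym: "transpose_mat ?E = ?E" and "pinv A * A * pinv A = pinv A"
    using is_pinv_pinv[OF A] by (simp_all add: is_pinv_def)
  with assoc_mult_mat[OF E P A] have EE: "?E * ?E = ?E" by simp
  have L: "bounded_linear ?L"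
    using linear_mat_op[OF E] by (simp add: linear_conv_bounded_linear)
  have idem: "?L (?L u) = ?L u" for u
    using mat_op_mult[OF E E, of u] by (simp add: EE)
  have self_adj: "inner (?L u) v = inner u (?L v)" for u v
    using inner_mat_op[OF E, of u v] by (simp add: Esym)
  have loss: "block_loss A b = (\<lambda>w. 1 / 2 * (norm (?L (w - a)))\<^sup>2)"
    by (simp add: fun_eq_iff block_loss_def realizable_residual[OF A b])
  show "convex_on UNIV (block_loss A b :: real ^ 'd \<Rightarrow> real)"
    and "smooth 1 (block_loss A b :: real ^ 'd \<Rightarrow> real)"
    and "gradient (block_loss A b) w = pinv_residual A b w"
    unfolding loss realizable_residual[OF A b]
    using half_norm_sq_projection[OF L idem self_adj] by (auto intro: gradient_eqI)
qed

theorem mainTheorem1: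
  fixes T :: nat
    and n :: "nat \<Rightarrow> nat"
    and X :: "nat \<Rightarrow> real mat"
    and y :: "nat \<Rightarrow> real vec"
    and f :: "nat \<Rightarrow> real ^ 'd \<Rightarrow> real"
  assumes "T \<ge> 1"
    and "\<And>m. m \<in> {1..T} \<Longrightarrow> X m \<in> carrier_mat (n m) CARD('d)"
    and "\<And>m. m \<in> {1..T} \<Longrightarrow> y m \<in> carrier_vec (n m)"
    and "\<exists>w :: real ^ 'd. \<forall>m\<in>{1..T}. X m *\<^sub>v coords w = y m"
    and "\<And>m. m \<in> {1..T} \<Longrightarrow> f m = block_loss (X m) (y m)"
  shows "(\<forall>m\<in>{1..T}. convex_on UNIV (f m) \<and> smooth 1 (f m)) \<and>
    (\<forall>k\<ge>1. \<forall>\<tau> \<in> {1..k} \<rightarrow> {1..T}. \<forall>t\<le>k. kaczmarz X y \<tau> t = sgd 1 f \<tau> t)"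
proof -
  obtain a :: "real ^ 'd" where a: "\<And>m. m \<in> {1..T} \<Longrightarrow> X m *\<^sub>v coords a = y m"
    using assms(4) by blast
  note block = realizable_block_loss[OF assms(2) a]
  \<comment> \<open>Both recursions start at 0 and subtract the same vector. The step to
    \<open>Suc t\<close> reads \<open>\<tau>\<close> at \<open>Suc t\<close>, which is in range
    since \<open>Suc t \<le> k\<close>.\<close>
  have "kaczmarz X y \<tau> t = sgd 1 f \<tau> t" if \<tau>: "\<tau> \<in> {1..k} \<rightarrow> {1..T}" and "t \<le> k" for k \<tau> t
    using \<open>t \<le> k\<close>
  proof (induction t)
    case (Suc t)
    then have "\<tau> (Suc t) \<in> {1..T}"
      using \<tau> by (auto simp: Pi_iff)
    with Suc show ?case
      by (simp add: block(3) assms(5))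
  qed simp
  then show ?thesis
    using block(1,2) by (simp add: assms(5))
qed

end
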